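(* Let $G=(V,E,\mathcal{I},\sigma)$ be a simple oriented hypergraph with edges labeled $e_1,\dots,e_m$, and let $k$ be a non-negative integer. Let $G^*$ be its incidence dual, whose vertices $v_i^*=e_i$ are the edges of $G$. Then the $(i,j)$-entry of $A_{G^*}^k$ equals $w^{\pm}(v_i^*,v_j^*;k)$ computed in $G^*$, which equals $w^{\pm}(e_i,e_j;k)$ computed in $G$.
   Context: An oriented hypergraph $G=(V,E,\mathcal{I},\sigma)$ consists of disjoint finite sets $V$ (vertices) and $E$ (edges), an incidence function $\iota:V\times E\to\mathbb{Z}_{\ge 0}$, the set $\mathcal{I}$ of incidences, i.e. triples $(v,e,k)$ with $\iota(v,e)\neq 0$ and $k\in\{1,\dots,\iota(v,e)\}$, and $\sigma:\mathcal{I}\to\{+1,-1\}$. $G$ is simple if $\iota(v,e)\le 1$ for all $v,e$; then write $(v,e)$ for $(v,e,1)$. The incidence dual of $G$ is $G^*=(E,V,\mathcal{I}^*,\sigma^* )$ (vertex set $E$, edge set $V$), with $\mathcal{I}^*=\{(e,v,k):(v,e,k)\in\mathcal{I}\}$ and $\sigma^*(e,v,k)=\sigma(v,e,k)$. In a simple oriented hypergraph, vertices $v,w$ are adjacent with respect to $e$ if there are distinct incidences $(v,e),(w,e)$, with sign $sgn_e(v,w)=-\sigma(v,e)\sigma(w,e)$ (and $sgn_e(v,w)=0$ if not adjacent); the adjacency matrix is $A_G=[a_{ij}]$, $a_{ij}=\sum_{e}sgn_e(v_i,v_j)$. A walk is a sequence $W=a_0,i_1,a_1,\dots,i_n,a_n$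 where $a_0,\dots,a_n$ alternate between vertices and edges, each $i_h$ is an incidence containing $a_{h-1}$ and $a_h$, and $i_{2h-1}\neq i_{2h}$ for all $h$ with $2h\le n$; its length is $n/2$ and its sign is $(-1)^{\lfloor n/2\rfloor}\prod_{h=1}^n\sigma(i_h)$. For anchors $a,b$, $w^{\pm}(a,b;k)$ is the number of positive walks of length $k$ from $a$ to $b$ minus the number of negative ones. *)

theory Defs
  imports "Jordan_Normal_Form.Matrix"
begin

text \<open>
  Vertices and edges live in one type, so that an anchor is either of the two and the incidence
  dual has the same type as the hypergraph. The values of \<open>inc_fun\<close> outside \<open>V \<times> E\<close> and of
  \<open>orient\<close> outside the set of incidences are irrelevant.
\<close>

type_synonym 'a incidence = "'a \<times> 'a \<times> nat"

record 'a ohg =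
  verts :: "'a set"
  edges :: "'a set"
  inc_fun :: "'a \<Rightarrow> 'a \<Rightarrow> nat"
  orient :: "'a incidence \<Rightarrow> int"

definition incidences :: "'a ohg \<Rightarrow> 'a incidence set" where
  "incidences G = {(v, e, k). v \<in> verts G \<and> e \<in> edges G \<and> inc_fun G v e \<noteq> 0
     \<and> k \<in> {1..inc_fun G v e}}"

definition oriented_hypergraph :: "'a ohg \<Rightarrow> bool" where
  "oriented_hypergraph G \<longleftrightarrow> finite (verts G) \<and> finite (edges G) \<and> verts G \<inter> edges G = {}
     \<and> orient G ` incidences G \<subseteq> {1, -1}"

definition simple_ohg :: "'a ohg \<Rightarrow> bool" where
  "simple_ohg G \<longleftrightarrow> (\<forall>v\<in>verts G. \<forall>e\<in>edges G. inc_fun G v e \<le> 1)"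

definition incidence_dual :: "'a ohg \<Rightarrow> 'a ohg" where
  "incidence_dual G = \<lparr>verts = edges G, edges = verts G,
     inc_fun = (\<lambda>e v. inc_fun G v e), orient = (\<lambda>(e, v, k). orient G (v, e, k))\<rparr>"

lemma incidences_dual:
  "incidences (incidence_dual G) = {(e, v, k). (v, e, k) \<in> incidences G}"
  by (auto simp: incidences_def incidence_dual_def)

lemma oriented_hypergraph_dual:
  "oriented_hypergraph G \<Longrightarrow> oriented_hypergraph (incidence_dual G)"
  unfolding oriented_hypergraph_def incidences_dual
  by (fastforce simp: incidence_dual_def)

lemma simple_ohg_dual: "simple_ohg G \<Longrightarrow> simple_ohg (incidence_dual G)"
  by (simp add: simple_ohg_def incidence_dual_def)


text \<open>
  The next three notions are meant for simple hypergraphs, where \<open>(v, e)\<close> abbreviates the only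
  possible incidence \<open>(v, e, 1)\<close>.
\<close>

definition adjacent_wrt :: "'a ohg \<Rightarrow> 'a \<Rightarrow> 'a \<Rightarrow> 'a \<Rightarrow> bool" where
  "adjacent_wrt G e v w \<longleftrightarrow> (v, e, 1) \<in> incidences G \<and> (w, e, 1) \<in> incidences G
     \<and> (v, e, 1 :: nat) \<noteq> (w, e, 1)"

definition adj_sign :: "'a ohg \<Rightarrow> 'a \<Rightarrow> 'a \<Rightarrow> 'a \<Rightarrow> int" where
  "adj_sign G e v w =
     (if adjacent_wrt G e v w then - (orient G (v, e, 1) * orient G (w, e, 1)) else 0)"

text \<open>The list \<open>vs\<close> is the labelling of the vertices, counted from \<open>0\<close>.\<close>

definition adjacency_matrix :: "'a ohg \<Rightarrow> 'a list \<Rightarrow> int mat" where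
  "adjacency_matrix G vs =
     mat (length vs) (length vs) (\<lambda>(i, j). \<Sum>e\<in>edges G. adj_sign G e (vs ! i) (vs ! j))"


text \<open>
  A walk \<open>a\<^sub>0, i\<^sub>1, a\<^sub>1, \<dots>, i\<^sub>n, a\<^sub>n\<close> is the pair of the lists \<open>[a\<^sub>0, \<dots>, a\<^sub>n]\<close> and \<open>[i\<^sub>1, \<dots>, i\<^sub>n]\<close>;
  thus \<open>i\<^sub>h\<close> is \<open>is ! (h - 1)\<close>.
\<close>

type_synonym 'a walk = "'a list \<times> 'a incidence list"

fun contains_anchor :: "'a incidence \<Rightarrow> 'a \<Rightarrow> bool" where
  "contains_anchor (v, e, k) a \<longleftrightarrow> a = v \<or> a = e"

fun is_walk :: "'a ohg \<Rightarrow> 'a walk \<Rightarrow> bool" where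
  "is_walk G (as, is) \<longleftrightarrow>
     length as = length is + 1
     \<and> set as \<subseteq> verts G \<union> edges G
     \<and> set is \<subseteq> incidences G
     \<and> (\<forall>h<length is. as ! h \<in> verts G \<and> as ! Suc h \<in> edges G
                    \<or> as ! h \<in> edges G \<and> as ! Suc h \<in> verts G)
     \<and> (\<forall>h\<in>{1..length is}. contains_anchor (is ! (h - 1)) (as ! (h - 1))
                         \<and> contains_anchor (is ! (h - 1)) (as ! h))
     \<and> (\<forall>h\<ge>1. 2 * h \<le> length is \<longrightarrow> is ! (2 * h - 2) \<noteq> is ! (2 * h - 1))"

fun walk_length :: "'a walk \<Rightarrow> rat" where
  "walk_length (as, is) = of_nat (length is) / 2"

fun walk_sign :: "'a ohg \<Rightarrow> 'a walk \<Rightarrow> int" where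
  "walk_sign G (as, is) = (-1) ^ (length is div 2) * (\<Prod>i\<leftarrow>is. orient G i)"

definition walks :: "'a ohg \<Rightarrow> 'a \<Rightarrow> 'a \<Rightarrow> rat \<Rightarrow> 'a walk set" where
  "walks G a b k =
     {W. is_walk G W \<and> hd (fst W) = a \<and> last (fst W) = b \<and> walk_length W = k}"

definition signed_walks :: "'a ohg \<Rightarrow> 'a \<Rightarrow> 'a \<Rightarrow> rat \<Rightarrow> int" where
  "signed_walks G a b k =
     int (card {W \<in> walks G a b k. walk_sign G W = 1})
     - int (card {W \<in> walks G a b k. walk_sign G W = -1})"

end

theory Submission
  imports Defs
begin

text \<open>
  A walk of length \<open>k + 1\<close> between vertices of a simple hypergraph is a pair of consecutive, distinct
  incidences \<open>(a, e, 1)\<close>, \<open>(c, e, 1)\<close> put in front of a walk of length \<open>k\<close>, and this pair contributes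
  the factor \<open>sgn\<^sub>e(a, c)\<close>. Hence the signed walk counts satisfy the recursion of the powers of the
  adjacency matrix. Swapping the two components of every incidence preserves walks, lengths and
  signs, which relates walks in \<open>G\<close> to walks in the dual.
\<close>

section \<open>Signed counts as sums of signs\<close>

lemma in_walks_iff:
  "(as, is) \<in> walks G a b (of_nat k) \<longleftrightarrow>
     is_walk G (as, is) \<and> hd as = a \<and> last as = b \<and> length is = 2 * k"
proof -
  have "(of_nat (length is) / 2 = (of_nat k :: rat)) \<longleftrightarrow>
      (of_nat (length is) = (of_nat (2 * k) :: rat))"
    by (simp add: field_simps)
  then show ?thesis
    unfolding walks_def of_nat_eq_iff by auto
qed

lemma walk_sign_values:
  assumes "oriented_hypergraph G" and "is_walk G W"
  shows "walk_sign G W = 1 \<or> walk_sign G W = -1"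
proof -
  have *: "(\<Prod>i\<leftarrow>is. orient G i) = 1 \<or> (\<Prod>i\<leftarrow>is. orient G i) = -1" if "set is \<subseteq> incidences G" for "is"
    using that
  proof (induction "is")
    case (Cons x xs)
    moreover have "orient G x = 1 \<or> orient G x = -1"
      using assms(1) Cons.prems by (auto simp: oriented_hypergraph_def)
    ultimately show ?case by auto
  qed simp
  obtain as "is" where W: "W = (as, is)" by (cases W)
  have "(-1::int) ^ (length is div 2) = 1 \<or> (-1::int) ^ (length is div 2) = -1"
    by (cases "even (length is div 2)") auto
  then show ?thesis
    using *[of "is"] assms(2) by (auto simp: W)
qed

text \<open>All signs are 1 or -1, so the walks split into two classes on which the sign is
  constant. Finiteness is assumed because \<open>sum\<close> and \<open>card\<close> are 0 on
  infinite sets: with one class infinite and the other finite and nonempty, the equation would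
  fail.\<close>

lemma signed_walks_eq_sum:
  assumes "oriented_hypergraph G" and fin: "finite (walks G a b k)"
  shows "signed_walks G a b k = (\<Sum>W\<in>walks G a b k. walk_sign G W)"
proof -
  let ?P = "{W \<in> walks G a b k. walk_sign G W = 1}"
  let ?N = "{W \<in> walks G a b k. walk_sign G W = -1}"
  have split: "walks G a b k = ?P \<union> ?N"
    using walk_sign_values[OF assms(1)] by (auto simp: walks_def)
  have "(\<Sum>W\<in>walks G a b k. walk_sign G W) = (\<Sum>W\<in>?P. walk_sign G W) + (\<Sum>W\<in>?N. walk_sign G W)"
    by (subst split, rule sum.union_disjoint) (use fin in auto)
  also have "\<dots> = signed_walks G a b k"
    by (simp add: signed_walks_def)
  finally show ?thesis by simp
qed

section \<open>Peeling off the first step of a walk\<close>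

lemma incidences_simple:
  assumes "simple_ohg G"
  shows "(v, e, n) \<in> incidences G \<Longrightarrow> n = 1"
  using assms by (fastforce simp: incidences_def simple_ohg_def)

text \<open>The distinctness condition compares incidences only inside the blocks (1,2), (3,4), and
  so on. Cutting off a whole block therefore leaves no condition across the cut, and
  \<open>p \<noteq> q\<close> turns into \<open>a \<noteq> c\<close>, which is part of
  adjacency.\<close>

lemma is_walk_Cons_Cons_iff:
  assumes "oriented_hypergraph G" and "simple_ohg G" and a: "a \<in> verts G"
  shows "is_walk G (a # e # c # as, p # q # is) \<longleftrightarrow>
    p = (a, e, 1) \<and> q = (c, e, 1) \<and> adjacent_wrt G e a c \<and> is_walk G (c # as, is)"
proof -
  have disj: "verts G \<inter> edges G = {}"
    using assms(1) by (simp add: oriented_hypergraph_def)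
  have all_Suc: "(\<forall>h<Suc n. P h) \<longleftrightarrow> P 0 \<and> (\<forall>h<n. P (Suc h))" for n and P :: "nat \<Rightarrow> bool"
    using less_Suc_eq_0_disj by auto
  have all_interval: "(\<forall>h\<in>{1..n}. P h) \<longleftrightarrow> (\<forall>h<n. P (Suc h))" for n and P :: "nat \<Rightarrow> bool"
    unfolding image_Suc_lessThan[symmetric] by auto
  \<comment> \<open>Counting blocks from 0 removes the truncated subtractions.\<close>
  have all_pairs: "(\<forall>h\<ge>1. 2 * h \<le> n \<longrightarrow> xs ! (2 * h - 2) \<noteq> xs ! (2 * h - 1)) \<longleftrightarrow>
      (\<forall>h. 2 * Suc h \<le> n \<longrightarrow> xs ! (2 * h) \<noteq> xs ! Suc (2 * h))" for n and xs :: "'a incidence list"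
  proof -
    have "(\<forall>h\<ge>1. Q h) \<longleftrightarrow> (\<forall>h. Q (Suc h))" for Q :: "nat \<Rightarrow> bool"
      by (metis One_nat_def Suc_le_D Suc_le_mono le0)
    then show ?thesis by simp
  qed
  have all_nat: "(\<forall>h. P h) \<longleftrightarrow> P 0 \<and> (\<forall>h. P (Suc h))" for P :: "nat \<Rightarrow> bool"
    by (metis not0_implies_Suc)
  \<comment> \<open>Block 0 is the pair \<open>p\<close>, \<open>q\<close>; block
    \<open>Suc h\<close> of the long list is block \<open>h\<close> of \<open>is\<close>.\<close>
  have pairs: "(\<forall>h. 2 * Suc h \<le> length (p # q # is) \<longrightarrow> (p # q # is) ! (2 * h) \<noteq> (p # q # is) ! Suc (2 * h))
      \<longleftrightarrow> p \<noteq> q \<and> (\<forall>h. 2 * Suc h \<le> length is \<longrightarrow> is ! (2 * h) \<noteq> is ! Suc (2 * h))"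
    by (subst all_nat) simp
  \<comment> \<open>Disjointness of vertices and edges decides which anchor is which component, and
    simplicity fixes the multiplicity index.\<close>
  have inc: "r = (v, f, 1)"
    if "r \<in> incidences G" "contains_anchor r v" "contains_anchor r f" "v \<in> verts G" "f \<in> edges G"
    for r v f
    using that disj incidences_simple[OF assms(2)] by (cases r) (auto simp: incidences_def)
  have split: "is_walk G (a # e # c # as, p # q # is) \<longleftrightarrow>
      is_walk G (c # as, is) \<and> p \<noteq> q \<and> p \<in> incidences G \<and> q \<in> incidences G
      \<and> a \<in> verts G \<union> edges G \<and> e \<in> verts G \<union> edges G
      \<and> (a \<in> verts G \<and> e \<in> edges G \<or> a \<in> edges G \<and> e \<in> verts G)
      \<and> (e \<in> verts G \<and> c \<in> edges G \<or> e \<in> edges G \<and> c \<in> verts G)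
      \<and> contains_anchor p a \<and> contains_anchor p e \<and> contains_anchor q e \<and> contains_anchor q c"
    unfolding is_walk.simps all_interval all_pairs pairs
    by (simp add: all_Suc) blast
  show ?thesis
  proof
    assume *: "is_walk G (a # e # c # as, p # q # is)"
    then have e: "e \<in> edges G" and c: "c \<in> verts G"
      unfolding split using a disj by blast+
    have "p = (a, e, 1)" "q = (c, e, 1)"
      using * inc[of p a e] inc[of q c e] a e c unfolding split by blast+
    then show "p = (a, e, 1) \<and> q = (c, e, 1) \<and> adjacent_wrt G e a c \<and> is_walk G (c # as, is)"
      using * unfolding split adjacent_wrt_def by simp
  next
    assume *: "p = (a, e, 1) \<and> q = (c, e, 1) \<and> adjacent_wrt G e a c \<and> is_walk G (c # as, is)"
    then have "e \<in> edges G" "c \<in> verts G"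
      by (auto simp: adjacent_wrt_def incidences_def)
    with * a show "is_walk G (a # e # c # as, p # q # is)"
      unfolding split adjacent_wrt_def by simp
  qed
qed

text \<open>Step and remaining walk form one argument so that they can range over a
  \<open>SIGMA\<close> set. The vertex \<open>c\<close> is not added as an anchor, since it is meant
  to be the head of \<open>as\<close> already.\<close>

definition prepend_step :: "('a \<times> 'a) \<times> 'a walk \<Rightarrow> 'a \<Rightarrow> 'a walk" where
  "prepend_step = (\<lambda>((c, e), (as, is)) a. (a # e # as, (a, e, 1) # (c, e, 1) # is))"

lemma walks_0:
  assumes "a \<in> verts G"
  shows "walks G a b 0 = (if a = b then {([a], [])} else {})"
proof -
  have "(as, is) \<in> walks G a b (of_nat 0) \<longleftrightarrow> as = [a] \<and> is = [] \<and> a = b" for as "is"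
    unfolding in_walks_iff using assms by (auto simp: length_Suc_conv)
  then show ?thesis by auto
qed

lemma walks_Suc:
  assumes "oriented_hypergraph G" and "simple_ohg G" and a: "a \<in> verts G"
  shows "walks G a b (of_nat (Suc k)) =
    (\<lambda>x. prepend_step x a) `
      (SIGMA y : {(c, e) \<in> verts G \<times> edges G. adjacent_wrt G e a c}. walks G (fst y) b (of_nat k))"
    (is "?L = ?R")
proof (intro equalityI subsetI)
  fix W assume W: "W \<in> ?L"
  obtain as' "is'" where W': "W = (as', is')" by (cases W)
  have walk: "is_walk G (as', is')" "hd as' = a" "last as' = b" "length is' = 2 * Suc k"
    using W by (simp_all only: W' in_walks_iff)
  \<comment> \<open>There is one anchor more than incidences, so three anchors can be
    exposed.\<close>
  then have "length as' = Suc (Suc (Suc (2 * k)))" by simp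
  with walk obtain e c as p q "is" where eqs: "as' = a # e # c # as" "is' = p # q # is"
    by (auto simp: length_Suc_conv)
  have *: "p = (a, e, 1)" "q = (c, e, 1)" "adjacent_wrt G e a c" "is_walk G (c # as, is)"
    using walk(1) unfolding eqs is_walk_Cons_Cons_iff[OF assms] by auto
  then have "(c # as, is) \<in> walks G c b (of_nat k)"
    unfolding in_walks_iff using walk eqs by simp
  moreover have "(c, e) \<in> verts G \<times> edges G"
    using *(3) by (auto simp: adjacent_wrt_def incidences_def)
  ultimately show "W \<in> ?R"
    using * by (intro image_eqI[of _ _ "((c, e), (c # as, is))"]) (auto simp: prepend_step_def W' eqs)
next
  fix W assume "W \<in> ?R"
  then obtain c e as "is" where *: "W = prepend_step ((c, e), (as, is)) a" "adjacent_wrt G e a c"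
      "(as, is) \<in> walks G c b (of_nat k)"
    by auto
  have w: "is_walk G (as, is)" "hd as = c" "last as = b" "length is = 2 * k"
    using *(3) unfolding in_walks_iff by auto
  then obtain as' where as: "as = c # as'" by (cases as) auto
  have "is_walk G (a # e # as, (a, e, 1) # (c, e, 1) # is)"
    unfolding as is_walk_Cons_Cons_iff[OF assms] using * w as by auto
  then show "W \<in> ?L"
    unfolding *(1) prepend_step_def prod.case in_walks_iff using w as by simp
qed

lemma finite_walks:
  assumes "oriented_hypergraph G" and "simple_ohg G" and "a \<in> verts G"
  shows "finite (walks G a b (of_nat k))"
  using assms(3)
proof (induction k arbitrary: a)
  case 0
  then show ?case by (simp add: walks_0)
next
  case (Suc k)
  have "finite (verts G \<times> edges G)"
    using assms(1) by (simp add: oriented_hypergraph_def)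
  then have "finite {(c, e) \<in> verts G \<times> edges G. adjacent_wrt G e a c}"
    by (rule rev_finite_subset) auto
  then show ?case
    unfolding walks_Suc[OF assms(1,2) Suc.prems] using Suc.IH
    by (intro finite_imageI finite_SigmaI) auto
qed

text \<open>Two more incidences raise the exponent \<open>length is div 2\<close> by exactly one;
  the resulting -1 and the two orientations make up the adjacency sign.\<close>

lemma walk_sign_prepend_step:
  assumes "adjacent_wrt G e a c"
  shows "walk_sign G (prepend_step ((c, e), W) a) = adj_sign G e a c * walk_sign G W"
  using assms by (cases W) (simp add: prepend_step_def adj_sign_def)

lemma signed_walks_Suc:
  assumes "oriented_hypergraph G" and "simple_ohg G" and a: "a \<in> verts G"
  shows "signed_walks G a b (of_nat (Suc k)) =
    (\<Sum>c\<in>verts G. (\<Sum>e\<in>edges G. adj_sign G e a c) * signed_walks G c b (of_nat k))"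
proof -
  let ?T = "{(c, e) \<in> verts G \<times> edges G. adjacent_wrt G e a c}"
  have fin: "finite (verts G \<times> edges G)"
    using assms(1) by (simp add: oriented_hypergraph_def)
  then have finT: "finite ?T"
    by (rule rev_finite_subset) auto
  let ?D = "SIGMA y : ?T. walks G (fst y) b (of_nat k)"
  \<comment> \<open>Everything can be read off the result: \<open>e\<close> and \<open>c\<close>
    from the second incidence, the remaining walk from the tails.\<close>
  have inj: "inj_on (\<lambda>x. prepend_step x a) ?D"
    by (auto simp: inj_on_def prepend_step_def)
  have "signed_walks G a b (of_nat (Suc k)) = (\<Sum>x\<in>?D. walk_sign G (prepend_step x a))"
    unfolding signed_walks_eq_sum[OF assms(1) finite_walks[OF assms]] walks_Suc[OF assms]
    by (subst sum.reindex[OF inj]) simp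
  also have "\<dots> = (\<Sum>(y, W)\<in>?D. adj_sign G (snd y) a (fst y) * walk_sign G W)"
    by (rule sum.cong) (auto simp: walk_sign_prepend_step)
  also have "\<dots> = (\<Sum>y\<in>?T. \<Sum>W\<in>walks G (fst y) b (of_nat k). adj_sign G (snd y) a (fst y) * walk_sign G W)"
    by (subst sum.Sigma) (use finT finite_walks[OF assms(1,2)] in \<open>auto simp: case_prod_beta\<close>)
  also have "\<dots> = (\<Sum>y\<in>?T. adj_sign G (snd y) a (fst y) * signed_walks G (fst y) b (of_nat k))"
    by (rule sum.cong)
      (auto simp: signed_walks_eq_sum[OF assms(1) finite_walks[OF assms(1,2)]] sum_distrib_left)
  \<comment> \<open>Pairs outside \<open>?T\<close> add nothing, because \<open>adj_sign\<close> is
    0 without adjacency.\<close>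
  also have "\<dots> = (\<Sum>y\<in>verts G \<times> edges G. adj_sign G (snd y) a (fst y) * signed_walks G (fst y) b (of_nat k))"
    by (rule sum.mono_neutral_left) (use fin in \<open>auto simp: adj_sign_def\<close>)
  also have "\<dots> = (\<Sum>c\<in>verts G. (\<Sum>e\<in>edges G. adj_sign G e a c) * signed_walks G c b (of_nat k))"
    by (simp add: sum.cartesian_product' sum_distrib_right)
  finally show ?thesis .
qed

section \<open>Powers of the adjacency matrix\<close>

lemma pow_mat_Suc_left:
  assumes "A \<in> carrier_mat n n"
  shows "A ^\<^sub>m Suc k = A * A ^\<^sub>m k"
proof (induction k)
  case 0
  then show ?case using assms by simp
next
  case (Suc k)
  have "A ^\<^sub>m Suc (Suc k) = (A * A ^\<^sub>m k) * A"
    using Suc by simp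
  also have "\<dots> = A * (A ^\<^sub>m k * A)"
    using assms by (intro assoc_mult_mat[of _ n n _ n _ n]) auto
  finally show ?case by simp
qed

text \<open>Matrix powers and signed counts obey the same recursion on \<open>k\<close>. The index
  \<open>i\<close> is generalized because the first step changes the starting vertex, while the end
  \<open>j\<close> stays fixed.\<close>

theorem adjacency_matrix_pow_eq_signed_walks:
  assumes "oriented_hypergraph G" and "simple_ohg G"
    and "distinct vs" and "set vs = verts G"
    and "i < length vs" and "j < length vs"
  shows "(adjacency_matrix G vs ^\<^sub>m k) $$ (i, j) = signed_walks G (vs ! i) (vs ! j) (of_nat k)"
  using assms(5)
proof (induction k arbitrary: i)
  case 0
  have dim: "dim_row (adjacency_matrix G vs) = length vs"
    by (simp add: adjacency_matrix_def)
  have v: "vs ! i \<in> verts G" using nth_mem[OF 0] assms(4) by simp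
  \<comment> \<open>Only the trivial walk, of sign 1, has length 0; distinct labels then yield the
    identity matrix.\<close>
  have "signed_walks G (vs ! i) (vs ! j) (of_nat 0) = (\<Sum>W\<in>walks G (vs ! i) (vs ! j) 0. walk_sign G W)"
    using signed_walks_eq_sum[OF assms(1) finite_walks[OF assms(1,2) v, of _ 0]] by simp
  also have "\<dots> = (if i = j then 1 else 0)"
    using 0 assms(3,6) by (simp add: walks_0[OF v] nth_eq_iff_index_eq)
  finally show ?case using 0 assms(6) by (simp add: dim)
next
  case (Suc k)
  let ?A = "adjacency_matrix G vs"
  have A: "?A \<in> carrier_mat (length vs) (length vs)"
    by (simp add: adjacency_matrix_def)
  have v: "vs ! i \<in> verts G" using nth_mem[OF Suc.prems] assms(4) by simp
  \<comment> \<open>The power is defined with its new factor on the right; it is moved to the left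
    to match the removal of the first step.\<close>
  have "(?A ^\<^sub>m Suc k) $$ (i, j) = (\<Sum>l<length vs. ?A $$ (i, l) * (?A ^\<^sub>m k) $$ (l, j))"
    unfolding pow_mat_Suc_left[OF A] using A pow_carrier_mat[OF A, of k] Suc.prems assms(6)
    by (simp add: scalar_prod_def lessThan_atLeast0)
  also have "\<dots> = (\<Sum>l<length vs. (\<Sum>e\<in>edges G. adj_sign G e (vs ! i) (vs ! l)) *
      signed_walks G (vs ! l) (vs ! j) (of_nat k))"
    using Suc by (intro sum.cong) (auto simp: adjacency_matrix_def)
  \<comment> \<open>The labelling is a bijection from indices to vertices.\<close>
  also have "\<dots> = (\<Sum>c\<in>verts G. (\<Sum>e\<in>edges G. adj_sign G e (vs ! i) c) *
      signed_walks G c (vs ! j) (of_nat k))"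
    using assms(3,4) by (intro sum.reindex_bij_betw bij_betw_nth) auto
  finally show ?case
    by (simp only: signed_walks_Suc[OF assms(1,2) v])
qed

section \<open>Walks in the incidence dual\<close>

definition dual_incidence :: "'a incidence \<Rightarrow> 'a incidence" where
  "dual_incidence = (\<lambda>(v, e, k). (e, v, k))"

text \<open>The anchors stay as they are, since vertices and edges share one type and only exchange
  roles.\<close>

definition dual_walk :: "'a walk \<Rightarrow> 'a walk" where
  "dual_walk = (\<lambda>(as, is). (as, map dual_incidence is))"

lemma dual_incidence_involutive [simp]: "dual_incidence (dual_incidence p) = p"
  by (cases p) (simp add: dual_incidence_def)

lemma dual_incidence_eq_iff [simp]: "dual_incidence p = dual_incidence q \<longleftrightarrow> p = q"
  by (metis dual_incidence_involutive)

lemma dual_walk_involutive [simp]: "dual_walk (dual_walk W) = W"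
  by (cases W) (simp add: dual_walk_def comp_def)

lemma incidence_dual_involutive [simp]: "incidence_dual (incidence_dual G) = (G :: 'a ohg)"
  by (simp add: incidence_dual_def)

lemma contains_anchor_dual [simp]: "contains_anchor (dual_incidence p) = contains_anchor p"
  by (cases p) (auto simp: dual_incidence_def)

lemma dual_incidence_mem [simp]:
  "dual_incidence p \<in> incidences (incidence_dual G) \<longleftrightarrow> p \<in> incidences G"
  by (cases p) (simp add: dual_incidence_def incidences_dual)

text \<open>The walk conditions are symmetric in vertices and edges, and swapping components is
  injective, so distinct incidences stay distinct.\<close>

lemma is_walk_dual:
  assumes "is_walk G W"
  shows "is_walk (incidence_dual G) (dual_walk W)"
proof -
  obtain as "is" where W: "W = (as, is)" by (cases W)
  have *: "verts (incidence_dual G) = edges G" "edges (incidence_dual G) = verts G"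
    by (simp_all add: incidence_dual_def)
  have "dual_incidence ` set is \<subseteq> incidences (incidence_dual G)"
    using assms by (auto simp: W)
  then show ?thesis
    using assms unfolding W dual_walk_def prod.case is_walk.simps * by auto
qed

lemma walk_sign_dual: "walk_sign (incidence_dual G) (dual_walk W) = walk_sign G W"
proof -
  have "orient (incidence_dual G) \<circ> dual_incidence = orient G"
    by (auto simp: incidence_dual_def dual_incidence_def)
  then show ?thesis
    by (cases W) (simp add: dual_walk_def)
qed

lemma walks_dual: "W \<in> walks G a b k \<Longrightarrow> dual_walk W \<in> walks (incidence_dual G) a b k"
  using is_walk_dual[of G W] by (cases W) (auto simp: walks_def dual_walk_def)

text \<open>The map \<open>dual_walk\<close> is its own inverse and keeps endpoints, length and
  sign, so it is a bijection between the walks of each sign.\<close>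

lemma signed_walks_dual:
  fixes G :: "'a ohg"
  shows "signed_walks (incidence_dual G) a b k = signed_walks G a b k"
proof -
  have "card {W \<in> walks (incidence_dual G) a b k. walk_sign (incidence_dual G) W = s}
      = card {W \<in> walks G a b k. walk_sign G W = s}" for s
  proof (rule bij_betw_same_card[of dual_walk], rule bij_betwI[of _ _ _ dual_walk])
    show "dual_walk \<in> {W \<in> walks (incidence_dual G) a b k. walk_sign (incidence_dual G) W = s}
        \<rightarrow> {W \<in> walks G a b k. walk_sign G W = s}"
      \<comment> \<open>The way back is the same fact for the dual, whose own dual is
        \<open>G\<close>.\<close>
      using walks_dual[of _ "incidence_dual G"] walk_sign_dual[of "incidence_dual G"] by auto
    show "dual_walk \<in> {W \<in> walks G a b k. walk_sign G W = s}
        \<rightarrow> {W \<in> walks (incidence_dual G) a b k. walk_sign (incidence_dual G) W = s}"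
      by (auto simp: walks_dual walk_sign_dual)
  qed auto
  then show ?thesis by (simp add: signed_walks_def)
qed

theorem theorem3p3:
  fixes G :: "'a ohg" and es :: "'a list" and k i j :: nat
  assumes "oriented_hypergraph G" and "simple_ohg G"
    and "distinct es" and "set es = edges G"
    and "i < length es" and "j < length es"
  shows "(adjacency_matrix (incidence_dual G) es ^\<^sub>m k) $$ (i, j)
           = signed_walks (incidence_dual G) (es ! i) (es ! j) (of_nat k)
       \<and> signed_walks (incidence_dual G) (es ! i) (es ! j) (of_nat k)
           = signed_walks G (es ! i) (es ! j) (of_nat k)"
proof
  \<comment> \<open>A labelling of the edges of \<open>G\<close> is a vertex labelling of the dual,
    so the result on vertex walks applies there.\<close>
  have "set es = verts (incidence_dual G)"
    using assms(4) by (simp add: incidence_dual_def)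
  then show "(adjacency_matrix (incidence_dual G) es ^\<^sub>m k) $$ (i, j)
      = signed_walks (incidence_dual G) (es ! i) (es ! j) (of_nat k)"
    by (rule adjacency_matrix_pow_eq_signed_walks[OF oriented_hypergraph_dual[OF assms(1)]
          simple_ohg_dual[OF assms(2)] assms(3) _ assms(5,6)])
qed (rule signed_walks_dual)

end
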